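(* Let $G$ be an equiarboreal graph. Then $G$ is resistance regular if and only if $G$ is degree regular.
   Context: All graphs are finite, simple, undirected and connected. A connected graph $G$ is equiarboreal if the number of spanning trees of $G$ containing a given edge is independent of the choice of the edge. $G$ is degree regular if all its vertex degrees are equal. The resistance distance $r_{ij}$ is the effective resistance between vertices $i$ and $j$ when each edge of $G$ carries a unit resistance; equivalently (known fact) $r_{ij}=L_{ii}^++L_{jj}^+-2L_{ij}^+$, where $L^+$ is the Moore-Penrose inverse of the Laplacian matrix $L=D-A$ of $G$. The resistance matrix is $R(G)=(r_{ij})$; $G$ is resistance regular if all row sums of $R(G)$ are equal. *)

theory Defs
  imports Complex_Main "Graph_Theory.Graph_Theory"
begin

text \<open>
  An undirected edge $uv$ is represented by the two arcs $(u,v)$ and $(v,u)$, so that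
  \<open>pair_graph\<close> is the notion of a finite simple undirected graph. Connectedness of the
  library includes non-emptiness of the vertex set.
\<close>

definition connected_simple_graph :: "'a pair_pre_digraph \<Rightarrow> bool" where
  "connected_simple_graph G \<longleftrightarrow> pair_graph G \<and> Digraph_Component.connected (with_proj G)"

text \<open>
  The library's \<open>forest\<close> and \<open>spanning_tree\<close> are not used: they forbid \<^emph>\<open>directed\<close> cycles
  of every length. This excludes the symmetric digraph of every undirected tree with an edge
  (because of the closed walk $u, v, u$), and it admits orientations of undirected cycles.
  Cycles of an undirected graph are the cycles of its symmetric digraph of length at least 3.
\<close>

definition undirected_tree :: "'a pair_pre_digraph \<Rightarrow> bool" where
  "undirected_tree T \<longleftrightarrow> connected_simple_graph T \<and>
     \<not> (\<exists>p. pre_digraph.cycle (with_proj T) p \<and> length p \<ge> 3)"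

definition undirected_spanning_trees :: "'a pair_pre_digraph \<Rightarrow> 'a pair_pre_digraph set" where
  "undirected_spanning_trees G = {T. undirected_tree T \<and> spanning (with_proj T) (with_proj G)}"

definition equiarboreal :: "'a pair_pre_digraph \<Rightarrow> bool" where
  "equiarboreal G \<longleftrightarrow> (\<forall>e \<in> parcs G. \<forall>f \<in> parcs G.
     card {T \<in> undirected_spanning_trees G. e \<in> parcs T} =
     card {T \<in> undirected_spanning_trees G. f \<in> parcs T})"

definition degree_regular :: "'a pair_pre_digraph \<Rightarrow> bool" where
  "degree_regular G \<longleftrightarrow> (\<forall>v \<in> pverts G. \<forall>w \<in> pverts G.
     out_degree (with_proj G) v = out_degree (with_proj G) w)"

text \<open>
  \<open>\<phi>\<close> is the electric potential when a unit current enters at \<open>s\<close> and leaves at \<open>t\<close> and every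
  edge is a unit resistor: by Ohm's law the current from \<open>v\<close> to \<open>w\<close> along an edge is
  \<open>\<phi> v - \<phi> w\<close>, and the equations are Kirchhoff's current law at every vertex. On a connected
  graph \<open>\<phi>\<close> exists and is unique up to an additive constant, so \<open>\<phi> s - \<phi> t\<close> is
  well defined.
\<close>

definition unit_current_potential ::
  "'a pair_pre_digraph \<Rightarrow> 'a \<Rightarrow> 'a \<Rightarrow> ('a \<Rightarrow> real) \<Rightarrow> bool" where
  "unit_current_potential G s t \<phi> \<longleftrightarrow>
     (\<forall>v \<in> pverts G. (\<Sum>w | (v, w) \<in> parcs G. \<phi> v - \<phi> w) = of_bool (v = s) - of_bool (v = t))"

definition resistance_distance :: "'a pair_pre_digraph \<Rightarrow> 'a \<Rightarrow> 'a \<Rightarrow> real" where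
  "resistance_distance G s t = (THE r. \<exists>\<phi>. unit_current_potential G s t \<phi> \<and> r = \<phi> s - \<phi> t)"

definition resistance_row_sum :: "'a pair_pre_digraph \<Rightarrow> 'a \<Rightarrow> real" where
  "resistance_row_sum G v = (\<Sum>w \<in> pverts G. resistance_distance G v w)"

definition resistance_regular :: "'a pair_pre_digraph \<Rightarrow> bool" where
  "resistance_regular G \<longleftrightarrow>
     (\<forall>v \<in> pverts G. \<forall>w \<in> pverts G. resistance_row_sum G v = resistance_row_sum G w)"

end

theory Submission
  imports Defs
begin

text \<open>
  Let $N$ be the number of spanning trees and $\phi(v)$ the number, divided by $N$, of spanning
  forests with two trees, one containing $s$ and $v$ and the other $t$. Adding an edge $vw$ to
  such a forest gives a spanning tree, so $N (\phi(v) - \phi(w))$ counts the trees whose path from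
  $s$ to $t$ traverses $vw$, with sign. In a fixed tree these signed counts form a unit flow, so
  $\phi$ is the potential of the unit current from $s$ to $t$. For an edge $st$ this yields
  Kirchhoff's formula: $r_{st}$ is the proportion of spanning trees containing $st$. In an
  equiarboreal graph $r_{st}$ is therefore a constant $c$ on the edges.

  Let $\ell$ be the diagonal of $L^+$. Then $r_{ij} = \ell_i + \ell_j - 2 L^+_{ij}$ and the row
  sums of $R$ are $n \ell_i + \mbox{tr}\, L^+$. Summing $r_{vw}$ over the neighbours $w$ of $v$ gives
  $c\, d_v + (L \ell)_v = 2 (1 - 1/n)$. Hence $\ell$ is constant iff $d$ is: if $d$ is constant then
  $L \ell$ is constant with sum zero, so $\ell$ is harmonic and thus constant.
\<close>

subsection \<open>Spanning trees and forests with two components\<close>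

definition add_edge :: "'a rel \<Rightarrow> 'a \<Rightarrow> 'a \<Rightarrow> 'a rel" where
  "add_edge F v w = insert (v, w) (insert (w, v) F)"

definition del_edge :: "'a rel \<Rightarrow> 'a \<Rightarrow> 'a \<Rightarrow> 'a rel" where
  "del_edge F v w = F - {(v, w), (w, v)}"

text \<open>Every edge is a bridge: this characterises the edge sets of forests without mentioning cycles.\<close>

definition all_bridges :: "'a rel \<Rightarrow> bool" where
  "all_bridges F \<longleftrightarrow> sym F \<and> (\<forall>a b. (a, b) \<in> F \<longrightarrow> (a, b) \<notin> (del_edge F a b)\<^sup>*)"

text \<open>A walk that crosses the new edge several times can be shortened until it crosses it at
  most once, in one of the two directions.\<close>

lemma rtrancl_add_edge:
  "(a, b) \<in> (add_edge F v w)\<^sup>* \<longleftrightarrow>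
     (a, b) \<in> F\<^sup>* \<or> (a, v) \<in> F\<^sup>* \<and> (w, b) \<in> F\<^sup>* \<or> (a, w) \<in> F\<^sup>* \<and> (v, b) \<in> F\<^sup>*"
  unfolding add_edge_def rtrancl_insert by (auto intro: rtrancl_trans)

lemma del_edge_commute: "del_edge F v w = del_edge F w v"
  by (auto simp: del_edge_def)

lemma sym_add_edge: "sym F \<Longrightarrow> sym (add_edge F v w)"
  by (auto simp: sym_def add_edge_def)

lemma sym_del_edge: "sym F \<Longrightarrow> sym (del_edge F v w)"
  by (auto simp: sym_def del_edge_def)

lemma add_del_edge: "sym F \<Longrightarrow> (v, w) \<in> F \<Longrightarrow> add_edge (del_edge F v w) v w = F"
  by (auto simp: sym_def add_edge_def del_edge_def)

lemma del_add_edge: "sym F \<Longrightarrow> (v, w) \<notin> F \<Longrightarrow> del_edge (add_edge F v w) v w = F"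
  by (auto simp: sym_def add_edge_def del_edge_def)

lemma rtrancl_sym: "sym F \<Longrightarrow> (a, b) \<in> F\<^sup>* \<Longrightarrow> (b, a) \<in> F\<^sup>*"
  by (meson sym_rtrancl symD)

lemma all_bridges_del_edge:
  assumes "all_bridges F" shows "all_bridges (del_edge F v w)"
proof -
  have "(del_edge (del_edge F v w) a b)\<^sup>* \<subseteq> (del_edge F a b)\<^sup>*" for a b
    by (rule rtrancl_mono) (auto simp: del_edge_def)
  then have "(a, b) \<notin> (del_edge (del_edge F v w) a b)\<^sup>*" if "(a, b) \<in> F" for a b
    using assms that unfolding all_bridges_def by blast
  moreover have "del_edge F v w \<subseteq> F" by (auto simp: del_edge_def)
  moreover have "sym (del_edge F v w)"
    using assms by (simp add: all_bridges_def sym_del_edge)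
  ultimately show ?thesis unfolding all_bridges_def by blast
qed

text \<open>The new edge joins different components, so it is a bridge. A detour around an old edge
  \<open>ab\<close> through the new edge would, closed up by \<open>(b, a)\<close>, connect
  \<open>v\<close> and \<open>w\<close> already in \<open>F\<close>.\<close>

lemma all_bridges_add_edge:
  assumes F: "all_bridges F" and vw: "(v, w) \<notin> F\<^sup>*"
  shows "all_bridges (add_edge F v w)"
  unfolding all_bridges_def
proof (intro conjI allI impI)
  have sym: "sym F" using F by (simp add: all_bridges_def)
  then show "sym (add_edge F v w)" by (rule sym_add_edge)
  fix a b assume ab: "(a, b) \<in> add_edge F v w"
  have vw': "(v, w) \<notin> F" "(w, v) \<notin> F\<^sup>*" using vw rtrancl_sym[OF sym] by auto
  show "(a, b) \<notin> (del_edge (add_edge F v w) a b)\<^sup>*"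
  proof (cases "(a, b) \<in> F")
    case False
    then have "a = v \<and> b = w \<or> a = w \<and> b = v" using ab by (auto simp: add_edge_def)
    then have "del_edge (add_edge F v w) a b = F"
      using del_add_edge[OF sym vw'(1)] del_edge_commute[of _ w v] by metis
    then show ?thesis using \<open>a = v \<and> b = w \<or> a = w \<and> b = v\<close> vw vw'(2) by metis
  next
    case True
    then have "(b, a) \<in> F" using sym by (auto dest: symD)
    have nb: "(a, b) \<notin> (del_edge F a b)\<^sup>*" using F True by (auto simp: all_bridges_def)
    have mono: "(del_edge F a b)\<^sup>* \<subseteq> F\<^sup>*" by (rule rtrancl_mono) (auto simp: del_edge_def)
    have "(w, v) \<notin> F" using vw' by auto
    then have "del_edge (add_edge F v w) a b = add_edge (del_edge F a b) v w"
      using True \<open>(b, a) \<in> F\<close> vw'(1) by (auto simp: del_edge_def add_edge_def)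
    moreover have "(a, b) \<notin> (add_edge (del_edge F a b) v w)\<^sup>*"
    proof
      assume "(a, b) \<in> (add_edge (del_edge F a b) v w)\<^sup>*"
      then have "(a, v) \<in> F\<^sup>* \<and> (w, b) \<in> F\<^sup>* \<or> (a, w) \<in> F\<^sup>* \<and> (v, b) \<in> F\<^sup>*"
        using nb mono by (auto simp: rtrancl_add_edge)
      then show False
        using \<open>(b, a) \<in> F\<close> vw vw' rtrancl_sym[OF sym] 
        by (meson converse_rtrancl_into_rtrancl rtrancl_trans)
    qed
    ultimately show ?thesis by simp
  qed
qed

section \<open>Spanning trees of a finite connected graph\<close>

locale finite_connected_graph =
  fixes V :: "'a set" and E :: "'a rel"
  assumes finite_V: "finite V" and V_nonempty: "V \<noteq> {}"
    and E_subset: "E \<subseteq> V \<times> V" and sym_E: "sym E"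
    and connected_E: "u \<in> V \<Longrightarrow> v \<in> V \<Longrightarrow> (u, v) \<in> E\<^sup>*"
begin

definition trees :: "'a rel set" where
  "trees = {T. T \<subseteq> E \<and> all_bridges T \<and> (\<forall>u\<in>V. \<forall>v\<in>V. (u, v) \<in> T\<^sup>*)}"

text \<open>For \<open>s = t\<close> reflexivity makes this set empty, so that
  \<open>tree_potential s s\<close> is zero, in accordance with a vanishing net current.\<close>

definition two_forests :: "'a \<Rightarrow> 'a \<Rightarrow> 'a rel set" where
  "two_forests s t = {F. F \<subseteq> E \<and> all_bridges F \<and> (s, t) \<notin> F\<^sup>* \<and>
     (\<forall>x\<in>V. (s, x) \<in> F\<^sup>* \<or> (t, x) \<in> F\<^sup>*)}"

lemma finite_E: "finite E"
  using finite_subset[OF E_subset] finite_V by simp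

lemma finite_trees: "finite trees"
  by (rule finite_subset[of _ "Pow E"]) (auto simp: trees_def finite_E)

lemma finite_two_forests: "finite (two_forests s t)"
  by (rule finite_subset[of _ "Pow E"]) (auto simp: two_forests_def finite_E)

text \<open>A connected spanning subgraph with the fewest arcs has only bridges: any other edge
  could be deleted without disconnecting it.\<close>

lemma trees_nonempty: "trees \<noteq> {}"
proof -
  let ?P = "\<lambda>F. F \<subseteq> E \<and> sym F \<and> (\<forall>u\<in>V. \<forall>v\<in>V. (u, v) \<in> F\<^sup>*)"
  have "?P E" using sym_E connected_E by auto
  then obtain T where T: "?P T" and min: "\<And>F. ?P F \<Longrightarrow> card T \<le> card F"
    using ex_has_least_nat[of ?P E card] by blast
  have "(a, b) \<notin> (del_edge T a b)\<^sup>*" if ab: "(a, b) \<in> T" for a b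
  proof
    assume c: "(a, b) \<in> (del_edge T a b)\<^sup>*"
    have sym: "sym (del_edge T a b)" using T by (simp add: sym_del_edge)
    have "(u, v) \<in> (del_edge T a b)\<^sup>*" if "u \<in> V" "v \<in> V" for u v
    proof -
      have "(u, v) \<in> (add_edge (del_edge T a b) a b)\<^sup>*"
        using T that ab by (simp add: add_del_edge)
      \<comment> \<open>A crossing of \<open>ab\<close> in either direction is replaced by the
        detour \<open>c\<close> or its reverse.\<close>
      then show ?thesis
        using c rtrancl_sym[OF sym c] unfolding rtrancl_add_edge by (meson rtrancl_trans)
    qed
    then have "?P (del_edge T a b)" using T sym by (auto simp: del_edge_def)
    then have "card T \<le> card (del_edge T a b)" by (rule min)
    moreover have "card (del_edge T a b) < card T"
      using T ab finite_subset[OF _ finite_E] by (intro psubset_card_mono) (auto simp: del_edge_def)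
    ultimately show False by simp
  qed
  then have "T \<in> trees" using T by (auto simp: trees_def all_bridges_def)
  then show ?thesis by blast
qed

lemma card_trees_pos: "card trees > 0"
  using trees_nonempty finite_trees by (simp add: card_gt_0_iff)

text \<open>Deleting a tree edge leaves exactly two sides: a vertex on both would give a detour
  around a bridge, a vertex on neither would be unreachable in \<open>T\<close>.\<close>

lemma tree_edge_side:
  assumes T: "T \<in> trees" and vw: "(v, w) \<in> T" and x: "x \<in> V"
  shows "(v, x) \<in> (del_edge T v w)\<^sup>* \<longleftrightarrow> (w, x) \<notin> (del_edge T v w)\<^sup>*"
proof
  have sym: "sym T" and nb: "(v, w) \<notin> (del_edge T v w)\<^sup>*"
    using T vw by (auto simp: trees_def all_bridges_def)
  note sym' = sym_del_edge[OF sym, of v w]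
  assume "(v, x) \<in> (del_edge T v w)\<^sup>*"
  then show "(w, x) \<notin> (del_edge T v w)\<^sup>*"
    using nb rtrancl_sym[OF sym'] by (meson rtrancl_trans)
next
  assume n: "(w, x) \<notin> (del_edge T v w)\<^sup>*"
  have sym: "sym T" and "v \<in> V" using T vw E_subset by (auto simp: trees_def all_bridges_def)
  then have "(v, x) \<in> (add_edge (del_edge T v w) v w)\<^sup>*"
    using T vw x by (simp add: add_del_edge trees_def)
  then show "(v, x) \<in> (del_edge T v w)\<^sup>*" using n by (auto simp: rtrancl_add_edge)
qed

lemma tree_first_step_exists:
  assumes T: "T \<in> trees" and v: "v \<in> V" and x: "x \<in> V" and "v \<noteq> x"
  shows "\<exists>w. (v, w) \<in> T \<and> (w, x) \<in> (del_edge T v w)\<^sup>*"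
proof -
  let ?T' = "{(a, b) \<in> T. a \<noteq> v \<and> b \<noteq> v}"
  have "(v, x) \<in> T\<^sup>*" using T v x by (simp add: trees_def)
  \<comment> \<open>The induction tracks the last departure from \<open>v\<close>; what follows it
    avoids \<open>v\<close> and hence survives the deletion of the edge \<open>vw\<close>.\<close>
  then have "x \<noteq> v \<longrightarrow> (\<exists>w. (v, w) \<in> T \<and> w \<noteq> v \<and> (w, x) \<in> ?T'\<^sup>*)"
  proof (induction rule: rtrancl_induct)
    case (step y z)
    show ?case
    proof (cases "y = v")
      case True then show ?thesis using step by auto
    next
      case False
      then show ?thesis using step by (auto intro: rtrancl_into_rtrancl)
    qed
  qed simp
  then obtain w where w: "(v, w) \<in> T" "(w, x) \<in> ?T'\<^sup>*" using \<open>v \<noteq> x\<close> by auto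
  have "?T'\<^sup>* \<subseteq> (del_edge T v w)\<^sup>*" by (rule rtrancl_mono) (auto simp: del_edge_def)
  then show ?thesis using w by auto
qed

lemma tree_first_step_unique:
  assumes T: "T \<in> trees"
    and w1: "(v, w1) \<in> T" "(w1, x) \<in> (del_edge T v w1)\<^sup>*"
    and w2: "(v, w2) \<in> T" "(w2, x) \<in> (del_edge T v w2)\<^sup>*"
  shows "w1 = w2"
proof (rule ccontr)
  assume ne: "w1 \<noteq> w2"
  have symT: "sym T" and nb1: "(v, w1) \<notin> (del_edge T v w1)\<^sup>*" and nb2: "(v, w2) \<notin> (del_edge T v w2)\<^sup>*"
    using T w1 w2 by (auto simp: trees_def all_bridges_def)
  let ?H = "del_edge (del_edge T v w1) v w2"
  have sub1: "?H\<^sup>* \<subseteq> (del_edge T v w1)\<^sup>*" by (rule rtrancl_mono) (auto simp: del_edge_def)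
  have sub2: "?H\<^sup>* \<subseteq> (del_edge T v w2)\<^sup>*" by (rule rtrancl_mono) (auto simp: del_edge_def)
  note sym1 = rtrancl_sym[OF sym_del_edge[OF symT, of v w1]]
  note sym2 = rtrancl_sym[OF sym_del_edge[OF symT, of v w2]]
  have vx1: "(v, x) \<notin> (del_edge T v w1)\<^sup>*" using nb1 sym1 w1 by (meson rtrancl_trans)
  have e2: "(v, w2) \<in> del_edge T v w1"
    using ne w2 symT nb1 w1 by (auto simp: del_edge_def)
  have "del_edge T v w2 = add_edge ?H v w1"
    using ne w1 w2 symT by (auto simp: del_edge_def add_edge_def dest: symD)
  \<comment> \<open>The walk from \<open>w2\<close> to \<open>x\<close> avoids the edge
    \<open>v w1\<close>, crosses it from \<open>v\<close> to \<open>w1\<close>, or crosses it from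
    \<open>w1\<close> to \<open>v\<close>. The first and third cases let \<open>v\<close> reach
    \<open>x\<close> without \<open>v w1\<close>; the second gives a detour around the bridge
    \<open>v w2\<close>.\<close>
  then have "(w2, x) \<in> ?H\<^sup>* \<or> (w2, v) \<in> ?H\<^sup>* \<and> (w1, x) \<in> ?H\<^sup>* \<or> (w2, w1) \<in> ?H\<^sup>* \<and> (v, x) \<in> ?H\<^sup>*"
    using w2 by (simp add: rtrancl_add_edge)
  moreover have "(w2, x) \<notin> ?H\<^sup>*"
    using sub1 e2 vx1 by (meson converse_rtrancl_into_rtrancl subsetD)
  moreover have "(w2, v) \<notin> ?H\<^sup>*" using sub2 nb2 sym2 by blast
  moreover have "(v, x) \<notin> ?H\<^sup>*" using sub1 vx1 by blast
  ultimately show False by blast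
qed

text \<open>The path from \<open>v\<close> to \<open>x\<close> in a tree has exactly one first edge,
  unless it is empty. This is the unit flow of a single tree, seen at \<open>v\<close>.\<close>

lemma card_tree_first_step:
  assumes T: "T \<in> trees" and v: "v \<in> V" and x: "x \<in> V"
  shows "card {w. (v, w) \<in> T \<and> (w, x) \<in> (del_edge T v w)\<^sup>*} = of_bool (v \<noteq> x)"
proof (cases "v = x")
  case True
  have "(w, x) \<notin> (del_edge T v w)\<^sup>*" if "(v, w) \<in> T" for w
    using tree_edge_side[OF T that x] True by simp
  then have none: "{w. (v, w) \<in> T \<and> (w, x) \<in> (del_edge T v w)\<^sup>*} = {}" by blast
  show ?thesis unfolding none using True by simp
next
  case False
  obtain w where "(v, w) \<in> T \<and> (w, x) \<in> (del_edge T v w)\<^sup>*"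
    using tree_first_step_exists[OF T v x False] by blast
  then have "{w. (v, w) \<in> T \<and> (w, x) \<in> (del_edge T v w)\<^sup>*} = {w}"
    using tree_first_step_unique[OF T] by blast
  then show ?thesis using False by simp
qed

text \<open>Adding \<open>vw\<close> joins the component of \<open>s\<close> to that of
  \<open>t\<close>, and deleting it undoes this. The trees obtained are those whose path from
  \<open>s\<close> to \<open>t\<close> crosses the edge from \<open>v\<close> to
  \<open>w\<close>.\<close>

lemma card_two_forests_eq_card_trees:
  assumes vw: "(v, w) \<in> E"
  shows "card {F \<in> two_forests s t. (s, v) \<in> F\<^sup>* \<and> (t, w) \<in> F\<^sup>*} =
    card {T \<in> trees. (v, w) \<in> T \<and> (v, s) \<in> (del_edge T v w)\<^sup>* \<and> (w, t) \<in> (del_edge T v w)\<^sup>*}"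
    (is "card ?A = card ?B")
proof (rule bij_betw_same_card[of "\<lambda>F. add_edge F v w"], rule bij_betw_byWitness[of _ "\<lambda>T. del_edge T v w"])
  have A: "(v, w) \<notin> F\<^sup>*" "sym F" if "F \<in> ?A" for F
  proof -
    show sym: "sym F" using that by (auto simp: two_forests_def all_bridges_def)
    show "(v, w) \<notin> F\<^sup>*"
      using that rtrancl_sym[OF sym] unfolding two_forests_def by (blast intro: rtrancl_trans)
  qed
  have B: "sym T" "(v, w) \<notin> (del_edge T v w)\<^sup>*" if "T \<in> ?B" for T
    using that by (auto simp: trees_def all_bridges_def)
  show inv: "\<forall>F\<in>?A. del_edge (add_edge F v w) v w = F"
    by (intro ballI del_add_edge A(2)) (use A(1) in auto)
  show "\<forall>T\<in>?B. add_edge (del_edge T v w) v w = T"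
    by (intro ballI add_del_edge B(1)) auto
  show "(\<lambda>F. add_edge F v w) ` ?A \<subseteq> ?B"
  proof clarify
    fix F assume F: "F \<in> two_forests s t" "(s, v) \<in> F\<^sup>*" "(t, w) \<in> F\<^sup>*"
    then have FA: "F \<in> ?A" by simp
    note sym = rtrancl_sym[OF A(2)[OF FA]]
    have side: "(v, x) \<in> F\<^sup>* \<or> (w, x) \<in> F\<^sup>*" if "x \<in> V" for x
      using that F sym unfolding two_forests_def by (blast intro: rtrancl_trans)
    have "add_edge F v w \<subseteq> E"
      using F vw sym_E by (auto simp: two_forests_def add_edge_def dest: symD)
    moreover have "all_bridges (add_edge F v w)"
      using F A(1)[OF FA] by (auto simp: two_forests_def intro: all_bridges_add_edge)
    moreover have "(a, b) \<in> (add_edge F v w)\<^sup>*" if "a \<in> V" "b \<in> V" for a b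
      using side[OF that(1)] side[OF that(2)] sym unfolding rtrancl_add_edge
      by (meson rtrancl_trans)
    ultimately have "add_edge F v w \<in> trees" by (auto simp: trees_def)
    then show "add_edge F v w \<in> trees \<and> (v, w) \<in> add_edge F v w \<and>
        (v, s) \<in> (del_edge (add_edge F v w) v w)\<^sup>* \<and> (w, t) \<in> (del_edge (add_edge F v w) v w)\<^sup>*"
      using inv[rule_format, OF FA] sym[OF F(2)] sym[OF F(3)] by (simp add: add_edge_def)
  qed
  show "(\<lambda>T. del_edge T v w) ` ?B \<subseteq> ?A"
  proof clarify
    fix T assume T: "T \<in> trees" "(v, w) \<in> T"
      "(v, s) \<in> (del_edge T v w)\<^sup>*" "(w, t) \<in> (del_edge T v w)\<^sup>*"
    then have TB: "T \<in> ?B" by simp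
    note sym = rtrancl_sym[OF sym_del_edge[OF B(1)[OF TB]]]
    have "del_edge T v w \<subseteq> E" "all_bridges (del_edge T v w)"
      using T all_bridges_del_edge by (auto simp: trees_def del_edge_def)
    moreover have "(s, t) \<notin> (del_edge T v w)\<^sup>*"
      using T B(2)[OF TB] sym by (meson rtrancl_trans)
    moreover have "(s, x) \<in> (del_edge T v w)\<^sup>* \<or> (t, x) \<in> (del_edge T v w)\<^sup>*" if "x \<in> V" for x
      using tree_edge_side[OF T(1,2) that] T(3,4) sym by (meson rtrancl_trans)
    ultimately show "del_edge T v w \<in> two_forests s t \<and>
       (s, v) \<in> (del_edge T v w)\<^sup>* \<and> (t, w) \<in> (del_edge T v w)\<^sup>*"
      using sym[OF T(3)] sym[OF T(4)] by (simp add: two_forests_def)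
  qed
qed

text \<open>Forests with \<open>v\<close> and \<open>w\<close> on the same side cancel; the others become trees by adding \<open>vw\<close>.\<close>

lemma card_two_forests_diff:
  assumes vw: "(v, w) \<in> E" and st: "s \<in> V" "t \<in> V"
  shows "real (card {F \<in> two_forests s t. (s, v) \<in> F\<^sup>*}) - real (card {F \<in> two_forests s t. (s, w) \<in> F\<^sup>*}) =
    (\<Sum>T\<in>trees. of_bool ((v, w) \<in> T \<and> (w, t) \<in> (del_edge T v w)\<^sup>*) -
                of_bool ((v, w) \<in> T \<and> (w, s) \<in> (del_edge T v w)\<^sup>*))"
proof -
  have vwV: "v \<in> V" "w \<in> V" and wv: "(w, v) \<in> E" using vw E_subset sym_E by (auto dest: symD)
  \<comment> \<open>Every vertex \<open>b\<close> lies on exactly one of the two sides of a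
    forest.\<close>
  have split: "card {F \<in> two_forests s t. (s, a) \<in> F\<^sup>*} =
      card {F \<in> two_forests s t. (s, a) \<in> F\<^sup>* \<and> (s, b) \<in> F\<^sup>*} +
      card {F \<in> two_forests s t. (s, a) \<in> F\<^sup>* \<and> (t, b) \<in> F\<^sup>*}" if "b \<in> V" for a b
  proof (subst card_Un_disjoint[symmetric])
    have "\<not> ((s, b) \<in> F\<^sup>* \<and> (t, b) \<in> F\<^sup>*)" if "F \<in> two_forests s t" for F
    proof -
      have "sym F" "(s, t) \<notin> F\<^sup>*" using that by (auto simp: two_forests_def all_bridges_def)
      then show ?thesis using rtrancl_sym by (meson rtrancl_trans)
    qed
    then show "{F \<in> two_forests s t. (s, a) \<in> F\<^sup>* \<and> (s, b) \<in> F\<^sup>*} \<inter>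
        {F \<in> two_forests s t. (s, a) \<in> F\<^sup>* \<and> (t, b) \<in> F\<^sup>*} = {}" by blast
    have "(s, b) \<in> F\<^sup>* \<or> (t, b) \<in> F\<^sup>*" if "F \<in> two_forests s t" for F
      using that \<open>b \<in> V\<close> by (auto simp: two_forests_def)
    then have "{F \<in> two_forests s t. (s, a) \<in> F\<^sup>*} =
      {F \<in> two_forests s t. (s, a) \<in> F\<^sup>* \<and> (s, b) \<in> F\<^sup>*} \<union>
      {F \<in> two_forests s t. (s, a) \<in> F\<^sup>* \<and> (t, b) \<in> F\<^sup>*}" by blast
    then show "card {F \<in> two_forests s t. (s, a) \<in> F\<^sup>*} =
      card ({F \<in> two_forests s t. (s, a) \<in> F\<^sup>* \<and> (s, b) \<in> F\<^sup>*} \<union>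
      {F \<in> two_forests s t. (s, a) \<in> F\<^sup>* \<and> (t, b) \<in> F\<^sup>*})" by simp
  qed (auto simp: finite_two_forests)
  have both: "{F \<in> two_forests s t. (s, w) \<in> F\<^sup>* \<and> (s, v) \<in> F\<^sup>*} =
      {F \<in> two_forests s t. (s, v) \<in> F\<^sup>* \<and> (s, w) \<in> F\<^sup>*}" by blast
  have mem: "(w, v) \<in> T \<longleftrightarrow> (v, w) \<in> T" if "T \<in> trees" for T
    using that by (auto simp: trees_def all_bridges_def dest: symD)
  have count: "real (card {T \<in> trees. P T}) = (\<Sum>T\<in>trees. of_bool (P T))" for P
    using finite_trees by (simp add: Int_def)
  have "real (card {F \<in> two_forests s t. (s, v) \<in> F\<^sup>*}) - real (card {F \<in> two_forests s t. (s, w) \<in> F\<^sup>*}) =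
    real (card {F \<in> two_forests s t. (s, v) \<in> F\<^sup>* \<and> (t, w) \<in> F\<^sup>*}) -
    real (card {F \<in> two_forests s t. (s, w) \<in> F\<^sup>* \<and> (t, v) \<in> F\<^sup>*})"
    using split[OF vwV(2), of v] split[OF vwV(1), of w] both by simp
  also have "\<dots> = (\<Sum>T\<in>trees.
      of_bool ((v, w) \<in> T \<and> (v, s) \<in> (del_edge T v w)\<^sup>* \<and> (w, t) \<in> (del_edge T v w)\<^sup>*) -
      of_bool ((w, v) \<in> T \<and> (w, s) \<in> (del_edge T w v)\<^sup>* \<and> (v, t) \<in> (del_edge T w v)\<^sup>*))"
    unfolding card_two_forests_eq_card_trees[OF vw] card_two_forests_eq_card_trees[OF wv] count
    by (rule sum_subtractf[symmetric])
  \<comment> \<open>In a tree containing \<open>vw\<close>, \<open>v\<close> reaches a vertex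
    exactly if \<open>w\<close> does not. Trees with \<open>s\<close> and \<open>t\<close> both on
    the side of \<open>w\<close> contribute 1 - 1 on the right, hence nothing on either side of the
    equation.\<close>
  also have "\<dots> = (\<Sum>T\<in>trees. of_bool ((v, w) \<in> T \<and> (w, t) \<in> (del_edge T v w)\<^sup>*) -
                of_bool ((v, w) \<in> T \<and> (w, s) \<in> (del_edge T v w)\<^sup>*))"
  proof (rule sum.cong[OF refl])
    fix T assume T: "T \<in> trees"
    show "(of_bool ((v, w) \<in> T \<and> (v, s) \<in> (del_edge T v w)\<^sup>* \<and> (w, t) \<in> (del_edge T v w)\<^sup>*) -
      of_bool ((w, v) \<in> T \<and> (w, s) \<in> (del_edge T w v)\<^sup>* \<and> (v, t) \<in> (del_edge T w v)\<^sup>*) :: real) =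
      of_bool ((v, w) \<in> T \<and> (w, t) \<in> (del_edge T v w)\<^sup>*) -
      of_bool ((v, w) \<in> T \<and> (w, s) \<in> (del_edge T v w)\<^sup>*)"
      unfolding mem[OF T] del_edge_commute[of T w v]
      using tree_edge_side[OF T _ st(1), of v w] tree_edge_side[OF T _ st(2), of v w] by auto
  qed
  finally show ?thesis .
qed

subsection \<open>Potentials and resistances\<close>

definition laplace :: "('a \<Rightarrow> real) \<Rightarrow> 'a \<Rightarrow> real" where
  "laplace h v = (\<Sum>w | (v, w) \<in> E. h v - h w)"

definition tree_potential :: "'a \<Rightarrow> 'a \<Rightarrow> 'a \<Rightarrow> real" where
  "tree_potential s t v = card {F \<in> two_forests s t. (s, v) \<in> F\<^sup>*} / card trees"

lemma finite_neighbours: "finite {w. (v, w) \<in> E}"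
  by (rule finite_subset[OF _ finite_V]) (use E_subset in auto)

lemma laplace_tree_potential:
  assumes v: "v \<in> V" and s: "s \<in> V" and t: "t \<in> V"
  shows "laplace (tree_potential s t) v = of_bool (v = s) - of_bool (v = t)"
proof -
  have steps: "(\<Sum>w | (v, w) \<in> E. of_bool ((v, w) \<in> T \<and> (w, x) \<in> (del_edge T v w)\<^sup>*)) = (of_bool (v \<noteq> x) :: real)"
    if T: "T \<in> trees" and x: "x \<in> V" for T x
  proof -
    have "{w. (v, w) \<in> E} \<inter> {w. (v, w) \<in> T \<and> (w, x) \<in> (del_edge T v w)\<^sup>*} =
      {w. (v, w) \<in> T \<and> (w, x) \<in> (del_edge T v w)\<^sup>*}" using T by (auto simp: trees_def)
    then show ?thesis
      using card_tree_first_step[OF T v x] by (simp add: finite_neighbours)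
  qed
  have "real (card trees) * laplace (tree_potential s t) v =
    (\<Sum>w | (v, w) \<in> E. real (card {F \<in> two_forests s t. (s, v) \<in> F\<^sup>*}) -
       real (card {F \<in> two_forests s t. (s, w) \<in> F\<^sup>*}))"
    using card_trees_pos
    by (simp add: laplace_def tree_potential_def diff_divide_distrib[symmetric] sum_divide_distrib[symmetric])
  also have "\<dots> = (\<Sum>w | (v, w) \<in> E. \<Sum>T\<in>trees.
      of_bool ((v, w) \<in> T \<and> (w, t) \<in> (del_edge T v w)\<^sup>*) -
      of_bool ((v, w) \<in> T \<and> (w, s) \<in> (del_edge T v w)\<^sup>*))"
    using card_two_forests_diff[OF _ s t] by (intro sum.cong) auto
  \<comment> \<open>After the exchange each tree is treated alone: at \<open>v\<close> it has one
    edge towards \<open>t\<close> unless \<open>v = t\<close>, and one towards \<open>s\<close>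
    unless \<open>v = s\<close>.\<close>
  also have "\<dots> = (\<Sum>T\<in>trees. \<Sum>w | (v, w) \<in> E.
      of_bool ((v, w) \<in> T \<and> (w, t) \<in> (del_edge T v w)\<^sup>*) -
      of_bool ((v, w) \<in> T \<and> (w, s) \<in> (del_edge T v w)\<^sup>*))"
    by (rule sum.swap)
  also have "\<dots> = (\<Sum>T\<in>trees. of_bool (v \<noteq> t) - of_bool (v \<noteq> s))"
    unfolding sum_subtractf using steps[OF _ s] steps[OF _ t] by simp
  also have "\<dots> = real (card trees) * (of_bool (v = s) - of_bool (v = t))" by auto
  finally show ?thesis using card_trees_pos by simp
qed

section \<open>Linearity of the Laplacian, harmonic functions and self-adjointness\<close>

lemma laplace_diff: "laplace (\<lambda>v. f v - g v) v = laplace f v - laplace g v"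
  unfolding laplace_def sum_subtractf[symmetric] by (intro sum.cong) auto

lemma laplace_const: "laplace (\<lambda>v. c) v = 0"
  by (simp add: laplace_def)

lemma laplace_sum: "laplace (\<lambda>v. \<Sum>i\<in>I. f i v) v = (\<Sum>i\<in>I. laplace (f i) v)"
proof -
  have "laplace (\<lambda>v. \<Sum>i\<in>I. f i v) v = (\<Sum>w | (v, w) \<in> E. \<Sum>i\<in>I. f i v - f i w)"
    by (simp add: laplace_def sum_subtractf)
  also have "\<dots> = (\<Sum>i\<in>I. laplace (f i) v)"
    unfolding laplace_def by (rule sum.swap)
  finally show ?thesis .
qed

lemma laplace_divide: "laplace (\<lambda>v. f v / c) v = laplace f v / c"
  by (simp add: laplace_def sum_divide_distrib diff_divide_distrib)

text \<open>Maximum principle: at a maximum the differences to the neighbours are nonnegative with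
  sum zero, so all vanish, and the maximal value spreads along paths to all of
  \<open>V\<close>.\<close>

lemma harmonic_imp_constant:
  assumes h: "\<And>v. v \<in> V \<Longrightarrow> laplace h v = 0" and uv: "u \<in> V" "v \<in> V"
  shows "h u = h v"
proof -
  obtain m where m: "m \<in> V" and "h m = Max (h ` V)"
    using Max_in[of "h ` V"] finite_V V_nonempty by (metis (mono_tags) finite_imageI image_iff image_is_empty)
  then have max: "h x \<le> h m" if "x \<in> V" for x using that finite_V by simp
  have "h x = h m" if "x \<in> V" for x
  proof -
    have "(m, x) \<in> E\<^sup>*" using connected_E m that by blast
    then show ?thesis
    proof (induction rule: rtrancl_induct)
      case (step y z)
      have y: "y \<in> V" using step E_subset by auto
      have "h y - h w = 0" if "w \<in> {w. (y, w) \<in> E}" for w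
      proof (rule sum_nonneg_eq_0_iff[THEN iffD1, rule_format, OF _ _ _ that])
        show "0 \<le> h y - h w" if "w \<in> {w. (y, w) \<in> E}" for w
          using that max E_subset step.IH by auto
        show "(\<Sum>w | (y, w) \<in> E. h y - h w) = 0" using h[OF y] by (simp add: laplace_def)
      qed (rule finite_neighbours)
      then show ?case using step by simp
    qed simp
  qed
  then show ?thesis using uv by metis
qed

lemma sum_neighbours: "(\<Sum>v\<in>V. \<Sum>w | (v, w) \<in> E. f v w) = (\<Sum>(v, w)\<in>E. f v w)"
proof -
  have "(SIGMA v:V. {w. (v, w) \<in> E}) = E" using E_subset by auto
  then show ?thesis using sum.Sigma[of V "\<lambda>v. {w. (v, w) \<in> E}" f] finite_V finite_neighbours by simp
qed

text \<open>Written over arcs, the degree terms agree at once, and reversing all arcs of the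
  symmetric relation \<open>E\<close> matches the mixed terms.\<close>

lemma laplace_self_adjoint: "(\<Sum>v\<in>V. f v * laplace h v) = (\<Sum>v\<in>V. h v * laplace f v)"
proof -
  have swap: "(\<Sum>(v, w)\<in>E. f v * h w) = (\<Sum>(v, w)\<in>E. f w * h v)"
    by (rule sum.reindex_bij_witness[of _ prod.swap prod.swap]) (use sym_E in \<open>auto dest: symD\<close>)
  have "(\<Sum>v\<in>V. f v * laplace h v) = (\<Sum>(v, w)\<in>E. f v * h v) - (\<Sum>(v, w)\<in>E. f v * h w)"
    unfolding laplace_def sum_distrib_left sum_neighbours
    by (simp add: case_prod_unfold right_diff_distrib sum_subtractf)
  also have "\<dots> = (\<Sum>(v, w)\<in>E. h v * f v) - (\<Sum>(v, w)\<in>E. h v * f w)"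
    unfolding swap by (simp add: mult.commute)
  also have "\<dots> = (\<Sum>v\<in>V. h v * laplace f v)"
    unfolding laplace_def sum_distrib_left sum_neighbours
    by (simp add: case_prod_unfold right_diff_distrib sum_subtractf)
  finally show ?thesis .
qed

section \<open>Effective resistance and the Green function\<close>

definition resistance :: "'a \<Rightarrow> 'a \<Rightarrow> real" where
  "resistance s t = (THE r. \<exists>\<phi>. (\<forall>v\<in>V. laplace \<phi> v = of_bool (v = s) - of_bool (v = t)) \<and> r = \<phi> s - \<phi> t)"

text \<open>Two potentials for the same current differ by a harmonic function, that is, by a
  constant, which cancels in the difference.\<close>

lemma resistance_eq:
  assumes "s \<in> V" "t \<in> V" and \<phi>: "\<And>v. v \<in> V \<Longrightarrow> laplace \<phi> v = of_bool (v = s) - of_bool (v = t)"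
  shows "resistance s t = \<phi> s - \<phi> t"
  unfolding resistance_def
proof (rule the_equality)
  show "\<exists>\<psi>. (\<forall>v\<in>V. laplace \<psi> v = of_bool (v = s) - of_bool (v = t)) \<and> \<phi> s - \<phi> t = \<psi> s - \<psi> t"
    using \<phi> by blast
next
  fix r assume "\<exists>\<psi>. (\<forall>v\<in>V. laplace \<psi> v = of_bool (v = s) - of_bool (v = t)) \<and> r = \<psi> s - \<psi> t"
  then obtain \<psi> where \<psi>: "\<forall>v\<in>V. laplace \<psi> v = of_bool (v = s) - of_bool (v = t)" "r = \<psi> s - \<psi> t"
    by blast
  have "\<psi> s - \<phi> s = \<psi> t - \<phi> t"
    by (rule harmonic_imp_constant[of "\<lambda>v. \<psi> v - \<phi> v"]) (use \<phi> \<psi> assms in \<open>auto simp: laplace_diff\<close>)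
  then show "r = \<phi> s - \<phi> t" using \<psi> by simp
qed

text \<open>Kirchhoff's formula. The tree potential vanishes at \<open>t\<close>, as no forest has
  \<open>s\<close> and \<open>t\<close> on one side; at \<open>s\<close> every forest counts, and
  adding \<open>st\<close> turns these into the trees containing \<open>st\<close>.\<close>

lemma resistance_edge:
  assumes st: "(s, t) \<in> E"
  shows "resistance s t = card {T \<in> trees. (s, t) \<in> T} / card trees"
proof -
  have V: "s \<in> V" "t \<in> V" using st E_subset by auto
  have "resistance s t = tree_potential s t s - tree_potential s t t"
    by (rule resistance_eq[OF V]) (rule laplace_tree_potential[OF _ V])
  moreover have "{F \<in> two_forests s t. (s, t) \<in> F\<^sup>*} = {}" by (auto simp: two_forests_def)
  then have "tree_potential s t t = 0" unfolding tree_potential_def by (simp only: card.empty)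
  moreover have "tree_potential s t s = card {T \<in> trees. (s, t) \<in> T} / card trees"
    using card_two_forests_eq_card_trees[OF st, of s t] by (simp add: tree_potential_def)
  ultimately show ?thesis by simp
qed

text \<open>\<open>green s v\<close> is the entry $L^+_{sv}$ of the Moore-Penrose inverse of the Laplacian.\<close>

definition green :: "'a \<Rightarrow> 'a \<Rightarrow> real" where
  "green s v = (\<Sum>t\<in>V. tree_potential s t v) / card V -
     (\<Sum>u\<in>V. (\<Sum>t\<in>V. tree_potential s t u) / card V) / card V"

lemma card_V_pos: "card V > 0"
  using finite_V V_nonempty by (simp add: card_gt_0_iff)

lemma sum_green: "(\<Sum>v\<in>V. green s v) = 0"
  using card_V_pos by (simp add: green_def sum_subtractf)

text \<open>Averaging the unit currents from \<open>s\<close> to all \<open>t\<close> gives a source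
  at \<open>s\<close> and a sink spread evenly over \<open>V\<close>. Together with zero row sums
  this characterises the row \<open>s\<close> of L^+.\<close>

lemma laplace_green:
  assumes "s \<in> V" "v \<in> V"
  shows "laplace (green s) v = of_bool (v = s) - 1 / card V"
proof -
  have "green s = (\<lambda>v. (\<Sum>t\<in>V. tree_potential s t v) / card V -
     (\<Sum>u\<in>V. (\<Sum>t\<in>V. tree_potential s t u) / card V) / card V)"
    by (simp add: green_def fun_eq_iff)
  then have "laplace (green s) v = (\<Sum>t\<in>V. of_bool (v = s) - of_bool (v = t)) / card V"
    using assms by (simp add: laplace_diff laplace_const laplace_divide laplace_sum laplace_tree_potential)
  also have "\<dots> = of_bool (v = s) - 1 / card V"
    using V_nonempty assms finite_V by (simp add: sum_subtractf diff_divide_distrib of_bool_def)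
  finally show ?thesis .
qed

lemma green_commute:
  assumes "s \<in> V" "t \<in> V"
  shows "green s t = green t s"
proof -
  \<comment> \<open>The source at \<open>b\<close> picks out \<open>green a b\<close>, while the
    uniform sink contributes nothing because \<open>green a\<close> sums to zero.\<close>
  have *: "(\<Sum>v\<in>V. green a v * laplace (green b) v) = green a b" if "b \<in> V" for a b
  proof -
    have "(\<Sum>v\<in>V. green a v * laplace (green b) v) =
        (\<Sum>v\<in>V. green a v * of_bool (v = b)) - (\<Sum>v\<in>V. green a v) / card V"
      using that by (simp add: laplace_green right_diff_distrib sum_subtractf sum_divide_distrib)
    then show ?thesis using that finite_V by (simp add: sum_green of_bool_def if_distrib cong: if_cong)
  qed
  show ?thesis using *[OF assms(1), of t] *[OF assms(2), of s] laplace_self_adjoint by metis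
qed

text \<open>By superposition the difference of the rows \<open>s\<close> and \<open>t\<close> is a
  potential for the unit current: the uniform sinks cancel.\<close>

lemma resistance_green:
  assumes "s \<in> V" "t \<in> V"
  shows "resistance s t = green s s + green t t - 2 * green s t"
proof -
  have "resistance s t = (green s s - green t s) - (green s t - green t t)"
    by (rule resistance_eq[OF assms, of "\<lambda>v. green s v - green t v"])
      (use assms in \<open>simp add: laplace_diff laplace_green\<close>)
  then show ?thesis using green_commute[OF assms] by simp
qed

lemma sum_resistance:
  assumes "s \<in> V"
  shows "(\<Sum>t\<in>V. resistance s t) = card V * green s s + (\<Sum>t\<in>V. green t t)"
  using assms by (simp add: resistance_green sum.distrib sum_subtractf sum_distrib_left[symmetric] sum_green)

text \<open>For each neighbour \<open>w\<close> the terms \<open>green w w\<close> cancel, which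
  leaves twice the Laplacian of the row \<open>green v\<close> at \<open>v\<close>.\<close>

lemma laplace_green_diagonal:
  assumes v: "v \<in> V"
  shows "(\<Sum>w | (v, w) \<in> E. resistance v w) + laplace (\<lambda>x. green x x) v = 2 * (1 - 1 / card V)"
proof -
  have "(\<Sum>w | (v, w) \<in> E. resistance v w) + laplace (\<lambda>x. green x x) v =
     (\<Sum>w | (v, w) \<in> E. 2 * (green v v - green v w))"
    unfolding laplace_def sum.distrib[symmetric]
    using E_subset v by (intro sum.cong) (auto simp: resistance_green)
  also have "\<dots> = 2 * laplace (green v) v"
    by (simp add: laplace_def sum_distrib_left)
  finally show ?thesis using laplace_green[OF v v] by simp
qed

lemma resistance_regular_iff_degree_regular:
  assumes c: "\<And>v w. (v, w) \<in> E \<Longrightarrow> resistance v w = c"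
  shows "(\<forall>v\<in>V. \<forall>w\<in>V. (\<Sum>x\<in>V. resistance v x) = (\<Sum>x\<in>V. resistance w x)) \<longleftrightarrow>
    (\<forall>v\<in>V. \<forall>w\<in>V. card {x. (v, x) \<in> E} = card {x. (w, x) \<in> E})"
    (is "?R \<longleftrightarrow> ?D")
proof -
  let ?l = "\<lambda>x. green x x" and ?d = "\<lambda>v. card {x. (v, x) \<in> E}"
  have key: "?d v * c + laplace ?l v = 2 * (1 - 1 / card V)" if "v \<in> V" for v
    using laplace_green_diagonal[OF that] c by simp
  have "?R \<longleftrightarrow> (\<forall>v\<in>V. \<forall>w\<in>V. ?l v = ?l w)"
    using card_V_pos by (simp add: sum_resistance)
  also have "\<dots> \<longleftrightarrow> ?D"
  proof
    assume l: "\<forall>v\<in>V. \<forall>w\<in>V. ?l v = ?l w"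
    show ?D
    proof (intro ballI)
      fix v w assume vw: "v \<in> V" "w \<in> V"
      have L: "laplace ?l x = 0" if "x \<in> V" for x
      proof -
        have "green x x - green w w = 0" if "(x, w) \<in> E" for w
          using l[rule_format, of x w] that E_subset by auto
        then show ?thesis unfolding laplace_def by (intro sum.neutral) simp
      qed
      have d: "?d v * c = 2 * (1 - 1 / card V)" "?d w * c = 2 * (1 - 1 / card V)"
        using key[OF vw(1)] key[OF vw(2)] L[OF vw(1)] L[OF vw(2)] by linarith+
      show "?d v = ?d w"
      proof (cases "c = 0")
        case False
        have "?d v * c = ?d w * c" using d by simp
        then show ?thesis using False by simp
      next
        \<comment> \<open>Here \<open>d\<close> reads 0 = 2 (1 - 1/n), so there is a single vertex
          and \<open>v = w\<close>.\<close>
        case True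
        then have "card V = 1" using d card_V_pos by (simp add: field_simps)
        then show ?thesis using vw by (metis card_1_singletonE singletonD)
      qed
    qed
  next
    assume D: ?D
    obtain u where u: "u \<in> V" using V_nonempty by blast
    have const: "laplace ?l v = laplace ?l u" if "v \<in> V" for v
      using key[OF that] key[OF u] D[rule_format, OF that u] by simp
    \<comment> \<open>A Laplacian sums to zero over \<open>V\<close>, by self-adjointness against
      the constant 1; being constant here, it vanishes everywhere.\<close>
    have "(\<Sum>v\<in>V. laplace ?l u) = (\<Sum>v\<in>V. 1 * laplace ?l v)"
      by (rule sum.cong[OF refl]) (simp add: const)
    also have "\<dots> = 0"
      unfolding laplace_self_adjoint[of "\<lambda>_. 1"] by (simp add: laplace_const)
    finally have "card V * laplace ?l u = 0" by simp
    then have "laplace ?l v = 0" if "v \<in> V" for v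
      using const[OF that] card_V_pos by simp
    then show "\<forall>v\<in>V. \<forall>w\<in>V. ?l v = ?l w" using harmonic_imp_constant by blast
  qed
  finally show ?thesis .
qed

end

subsection \<open>Transfer to the graph library\<close>

lemma pcas_rtrancl: "pcas u p v \<Longrightarrow> set p \<subseteq> R \<Longrightarrow> (u, v) \<in> R\<^sup>*"
proof (induction p arbitrary: u)
  case (Cons e p)
  then have "(u, snd e) \<in> R" "(snd e, v) \<in> R\<^sup>*" by auto
  then show ?case by (rule converse_rtrancl_into_rtrancl)
qed simp

lemma pawalk_verts_conv: "pcas u p v \<Longrightarrow> pawalk_verts u p = map fst p @ [v]"
  by (induction p arbitrary: u) auto

text \<open>The arcs are symmetric and stay within the vertex set, so neither the symmetric closure
  nor the restriction of reachability to \<open>pverts T\<close> changes anything.\<close>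

lemma pair_graph_connected_iff:
  assumes "pair_graph T"
  shows "Digraph_Component.connected (with_proj T) \<longleftrightarrow>
    pverts T \<noteq> {} \<and> (\<forall>u\<in>pverts T. \<forall>v\<in>pverts T. (u, v) \<in> (parcs T)\<^sup>*)"
proof -
  interpret T: pair_graph T by fact
  have "(parcs T)\<^sup>s = parcs T"
    using T.arcs_symmetric by (auto simp: symcl_def)
  moreover have "(u, v) \<in> rtrancl_on (pverts T) (parcs T) \<longleftrightarrow> (u, v) \<in> (parcs T)\<^sup>*"
    if "u \<in> pverts T" "v \<in> pverts T" for u v
    using that rtrancl_consistent_rtrancl_on[of u v "parcs T" "pverts T"] T.in_arcsD2
      rtrancl_on_rtranclI[of u v "pverts T" "parcs T"] by blast
  ultimately show ?thesis by (simp add: connected_conv)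
qed

text \<open>A simple path around an edge closes up with that edge to a cycle; conversely, a cycle
  without its first arc is a detour around that arc.\<close>

lemma pair_graph_acyclic_iff:
  assumes "pair_graph T"
  shows "\<not> (\<exists>p. pre_digraph.cycle (with_proj T) p \<and> length p \<ge> 3) \<longleftrightarrow> all_bridges (parcs T)"
proof -
  interpret T: pair_graph T by fact
  have sym: "sym (parcs T)" using T.arcs_symmetric by (auto simp: sym_def)
  have "\<exists>p. T.cycle p \<and> length p \<ge> 3"
    if ab: "(a, b) \<in> parcs T" "(a, b) \<in> (del_edge (parcs T) a b)\<^sup>*" for a b
  proof -
    let ?D = "\<lparr>pverts = pverts T, parcs = del_edge (parcs T) a b\<rparr>"
    interpret D: pair_wf_digraph ?D
      by unfold_locales (auto simp: del_edge_def dest: T.in_arcsD1 T.in_arcsD2)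
    have "(a, b) \<in> rtrancl_on (pverts T) (del_edge (parcs T) a b)"
      using ab T.in_arcsD1 T.in_arcsD2
      by (intro rtrancl_consistent_rtrancl_on) (auto simp: del_edge_def)
    then obtain p where "D.apath a p b"
      using D.reachable_apath[of a b] by (auto simp: reachable_def)
    then have p: "pcas a p b" "set p \<subseteq> del_edge (parcs T) a b" "distinct (pawalk_verts a p)"
      by (auto simp: D.apath_def D.awalk_def)
    \<comment> \<open>An empty path would make \<open>(a, b)\<close> a loop, and a single arc would
      be the deleted one; hence the cycle has length at least 3.\<close>
    have "p \<noteq> []" using p(1) T.no_loops'[OF ab(1)] by auto
    moreover have "p \<noteq> [e]" for e using p(1,2) by (cases e) (auto simp: del_edge_def)
    ultimately have "length p \<ge> 2" by (cases p; cases "tl p") auto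
    moreover have "T.awalk b ((b, a) # p) b"
      using p ab T.in_arcsD2 T.arcs_symmetric by (auto simp: T.awalk_def del_edge_def)
    ultimately have "T.cycle ((b, a) # p) \<and> length ((b, a) # p) \<ge> 3"
      using p(3) by (auto simp: T.cycle_def)
    then show ?thesis by blast
  qed
  moreover have "\<not> all_bridges (parcs T)" if cyc: "T.cycle p" "length p \<ge> 3" for p
  proof -
    obtain u where u: "T.awalk u p u" "distinct (tl (pawalk_verts u p))"
      using cyc(1) by (auto simp: T.cycle_def)
    then obtain v q where p: "p = (u, v) # q"
      using cyc(2) by (cases p) (auto simp: T.awalk_def)
    then have q: "pcas v q u" "set q \<subseteq> parcs T" "distinct (pawalk_verts v q)" "(u, v) \<in> parcs T"
      and len: "length q \<ge> 2"
      using u cyc(2) by (auto simp: T.awalk_def)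
    have d: "distinct (map fst q)" "u \<notin> fst ` set q"
      using q(3) unfolding pawalk_verts_conv[OF q(1)] by auto
    obtain x y r where r: "q = (v, x) # (x, y) # r"
    proof -
      obtain e f r where "q = e # f # r" using len by (cases q; cases "tl q") auto
      then show ?thesis using q(1) that by (cases e; cases f) auto
    qed
    \<comment> \<open>No arc of \<open>q\<close> starts at \<open>u\<close>, and only the first
      starts at \<open>v\<close>. Its head \<open>x\<close> is the start of a further arc, as the
      cycle has length at least 3, so \<open>x\<close> is not \<open>u\<close>.\<close>
    have "(u, v) \<notin> set q" using d(2) by force
    moreover have "(v, u) \<notin> set q" using d r by force
    ultimately have "set q \<subseteq> del_edge (parcs T) u v" using q(2) by (auto simp: del_edge_def)
    then have "(v, u) \<in> (del_edge (parcs T) u v)\<^sup>*" using pcas_rtrancl[OF q(1)] by blast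
    then have "(u, v) \<in> (del_edge (parcs T) u v)\<^sup>*" by (rule rtrancl_sym[OF sym_del_edge[OF sym]])
    then show ?thesis using q(4) by (auto simp: all_bridges_def)
  qed
  ultimately show ?thesis using sym unfolding all_bridges_def by blast
qed

lemma undirected_tree_iff:
  assumes "pair_graph T"
  shows "undirected_tree T \<longleftrightarrow> pverts T \<noteq> {} \<and>
    (\<forall>u\<in>pverts T. \<forall>v\<in>pverts T. (u, v) \<in> (parcs T)\<^sup>*) \<and> all_bridges (parcs T)"
  unfolding undirected_tree_def connected_simple_graph_def
    pair_graph_acyclic_iff[OF assms] pair_graph_connected_iff[OF assms]
  using assms by simp

lemma connected_simple_graph_finite_connected_graph:
  assumes "connected_simple_graph G"
  shows "finite_connected_graph (pverts G) (parcs G)"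
proof -
  have G: "pair_graph G" using assms by (simp add: connected_simple_graph_def)
  interpret G: pair_graph G by fact
  show ?thesis
    using assms G.pair_finite_verts G.in_arcsD1 G.in_arcsD2 G.arcs_symmetric
    unfolding connected_simple_graph_def pair_graph_connected_iff[OF G]
    by unfold_locales (auto simp: sym_def)
qed

text \<open>Since the vertex set is prescribed, a spanning tree amounts to its arc set; any
  symmetric set of arcs of \<open>G\<close> on all of \<open>pverts G\<close> is again a simple
  graph.\<close>

lemma undirected_spanning_trees_iff:
  assumes "connected_simple_graph G"
  shows "T \<in> undirected_spanning_trees G \<longleftrightarrow>
    pverts T = pverts G \<and> parcs T \<in> finite_connected_graph.trees (pverts G) (parcs G)"
proof -
  have "pair_graph G" using assms by (simp add: connected_simple_graph_def)
  then interpret G: pair_graph G .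
  interpret FG: finite_connected_graph "pverts G" "parcs G"
    using assms by (rule connected_simple_graph_finite_connected_graph)
  have pg: "pair_graph T" if "pverts T = pverts G" "parcs T \<subseteq> parcs G" "sym (parcs T)"
  proof -
    have "finite (parcs T)" using that finite_subset[OF _ FG.finite_E] by blast
    moreover have "e \<in> parcs T \<Longrightarrow> fst e \<noteq> snd e" for e using that G.pair_no_loops by auto
    moreover have "symmetric (with_proj T)" using that by (simp add: symmetric_def)
    moreover have "e \<in> parcs T \<Longrightarrow> fst e \<in> pverts T" "e \<in> parcs T \<Longrightarrow> snd e \<in> pverts T" for e
      using that G.arc_fst_in_verts G.arc_snd_in_verts by auto
    ultimately show ?thesis using that FG.finite_V by unfold_locales simp_all
  qed
  have spanning: "spanning (with_proj T) (with_proj G) \<longleftrightarrow> pverts T = pverts G \<and> parcs T \<subseteq> parcs G"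
    if "pair_graph T"
  proof -
    interpret T: pair_graph T by fact
    have "wf_digraph (with_proj T)" "wf_digraph (with_proj G)" by unfold_locales
    then show ?thesis by (auto simp: spanning_def subgraph_def)
  qed
  show ?thesis
  proof
    assume T: "T \<in> undirected_spanning_trees G"
    then have "pair_graph T"
      by (simp add: undirected_spanning_trees_def undirected_tree_def connected_simple_graph_def)
    then show "pverts T = pverts G \<and> parcs T \<in> FG.trees"
      using T undirected_tree_iff[of T] spanning
      by (simp add: undirected_spanning_trees_def FG.trees_def)
  next
    assume T: "pverts T = pverts G \<and> parcs T \<in> FG.trees"
    then have "pair_graph T"
      by (intro pg) (auto simp: FG.trees_def all_bridges_def)
    then show "T \<in> undirected_spanning_trees G"
      using T undirected_tree_iff[of T] spanning FG.V_nonempty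
      by (simp add: undirected_spanning_trees_def FG.trees_def)
  qed
qed

lemma card_undirected_spanning_trees_containing:
  assumes G: "connected_simple_graph G"
  shows "card {T \<in> undirected_spanning_trees G. e \<in> parcs T} =
    card {T \<in> finite_connected_graph.trees (pverts G) (parcs G). e \<in> T}"
  by (rule bij_betw_same_card[of parcs], rule bij_betw_byWitness[of _ "\<lambda>F. \<lparr>pverts = pverts G, parcs = F\<rparr>"])
    (auto simp: undirected_spanning_trees_iff[OF G])

lemma out_degree_with_proj: "out_degree (with_proj G) v = card {w. (v, w) \<in> parcs G}"
  unfolding out_degree_def
  by (rule bij_betw_same_card[of snd], rule bij_betw_byWitness[of _ "\<lambda>w. (v, w)"]) (auto simp: out_arcs_def)

theorem theorem2p25:
  fixes G :: "'a pair_pre_digraph"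
  assumes "connected_simple_graph G"
    and "equiarboreal G"
  shows "resistance_regular G \<longleftrightarrow> degree_regular G"
proof -
  interpret finite_connected_graph "pverts G" "parcs G"
    using assms(1) by (rule connected_simple_graph_finite_connected_graph)
  have res: "resistance_distance G s t = resistance s t" for s t
    by (simp add: resistance_distance_def resistance_def unit_current_potential_def laplace_def)
  \<comment> \<open>The common number of trees through an edge; it is arbitrary if there are no
    edges.\<close>
  obtain c where c: "card {T \<in> trees. e \<in> T} = c" if "e \<in> parcs G" for e
    using assms(2) unfolding equiarboreal_def card_undirected_spanning_trees_containing[OF assms(1)]
    by blast
  then have "resistance v w = c / card trees" if "(v, w) \<in> parcs G" for v w
    using resistance_edge[OF that] c[OF that] by simp
  then show ?thesis
    using resistance_regular_iff_degree_regular[of "c / card trees"]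
    by (simp add: resistance_regular_def degree_regular_def resistance_row_sum_def res out_degree_with_proj)
qed

end
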